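(* Let $\mu=\sum_{i=1}^n\lambda_i\,\delta(x_i,y_i)$ be a given finitely atomic probability measure on $\mathbb{R}^2$. Then the following characterization can be used to construct a Gröbner basis for the recursive relations for $\mu$: a polynomial $p\in\mathbb{R}_k[x,y]$ is a recursive relation for $M(\mu)(k)$ if and only if $\hat p\in\ker\big(V(\mu)(k)\big)$.
   Context: $\delta(a,b)$ denotes the point-mass probability measure supported at $(a,b)\in\mathbb{R}^2$. A finitely atomic probability measure is a probability measure of the form $\mu=\sum_{i=1}^n\lambda_i\delta(x_i,y_i)$ with $(x_i,y_i)\in\mathbb{R}^2$ and real $\lambda_i>0$. For an integer $k\ge 1$, $\mathbb{R}_k[x,y]$ is the space of real polynomials in $x,y$ of total degree at most $k$, with monomials listed in the order $1,x,y,x^2,xy,y^2,\dots,xy^{k-1},y^k$; $\hat p$ denotes the column vector of coefficients of $p$ with respect to this monomial basis. $M(\mu)(k)$ is the moment matrix with rows and columns indexed by the monomials of degree at most $k$, whose entry in row $x^ay^b$ and column $x^cy^e$ is $\int x^{a+c}y^{b+e}\,d\mu$; $M(\mu)$ is the infinite matrix defined in the same way with rows and columns indexed by all monomials in $x,y$. A polynomial $p\in\mathbb{R}_k[x,y]$ is a recursive relation for $M(\mu)(k)$ if $M(\mu)(k)\cdot\hat p=\boldsymbol 0$. Likewise, $p\in\mathbb{R}[x,y]$ is a recursive relation for $M(\mu)$ if $M(\mu)\cdot\hat p=\boldsymbol 0$, where $\hat p$ is now the finitely supported coefficient vector indexed by all monomials. The recursive relations for $\mu$ are the recursive relations for $M(\mu)$;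 they form an ideal $\mathcal{I}$ of $\mathbb{R}[x,y]$ (a known fact). The 2-variable Vandermonde-like matrix $V(\mu)(k)$ has $n$ rows, and columns indexed by the monomials of degree at most $k$ in the order above; its entry in row $i$ and column $x^cy^e$ is $x_i^cy_i^e$. A set $\mathcal{G}\subseteq\mathcal{I}$ is a Gröbner basis for $\mathcal{I}$ if the leading terms of the elements of $\mathcal{G}$ are sufficient to generate all the leading terms of polynomials in $\mathcal{I}$. Leading terms are taken with respect to the lexicographic ordering. *)

theory Defs
  imports
    "HOL-Probability.Giry_Monad"
    "HOL-Library.Poly_Mapping"
    "Jordan_Normal_Form.Matrix_Kernel"
begin

text \<open>The exponent pair \<open>(a, b)\<close> stands for the monomial $x^a y^b$. Real polynomials in \<open>x\<close> and \<open>y\<close>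
  are the finitely supported coefficient functions on exponent pairs; the library's multiplication
  on this type is convolution over the componentwise addition of exponents, so the type is the
  ring $R[x,y]$.\<close>

type_synonym monom2 = "nat \<times> nat"

type_synonym poly2 = "monom2 \<Rightarrow>\<^sub>0 real"

definition polys_upto :: "nat \<Rightarrow> poly2 set" where
  "polys_upto k = {p. \<forall>m \<in> Poly_Mapping.keys p. fst m + snd m \<le> k}"

text \<open>The order is 1, x, y, x^2, xy, y^2, and so on: increasing total degree, and within
  each degree decreasing exponent of \<open>x\<close>.\<close>

definition monomials_upto :: "nat \<Rightarrow> monom2 list" where
  "monomials_upto k = concat (map (\<lambda>d. map (\<lambda>j. (d - j, j)) [0..<Suc d]) [0..<Suc k])"

definition coeff_vec :: "nat \<Rightarrow> poly2 \<Rightarrow> real vec" where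
  "coeff_vec k p =
     vec (length (monomials_upto k)) (\<lambda>c. Poly_Mapping.lookup p (monomials_upto k ! c))"

text \<open>The atoms are numbered from \<open>0\<close> to \<open>n - 1\<close>. The last conjunct says
  $\mu = \sum_{i<n} \lambda_i \delta(x_i, y_i)$, where \<open>return borel z\<close> is the point mass
  at \<open>z\<close>. The atoms need not be distinct.\<close>

definition finitely_atomic_prob ::
  "(real \<times> real) measure \<Rightarrow> nat \<Rightarrow> (nat \<Rightarrow> real) \<Rightarrow> (nat \<Rightarrow> real) \<Rightarrow> (nat \<Rightarrow> real) \<Rightarrow> bool" where
  "finitely_atomic_prob \<mu> n w x y \<longleftrightarrow>
     prob_space \<mu> \<and> sets \<mu> = sets borel \<and> (\<forall>i<n. 0 < w i) \<and>
     (\<forall>A \<in> sets borel.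
        emeasure \<mu> A = (\<Sum>i<n. ennreal (w i) * emeasure (return borel (x i, y i)) A))"

definition moment_entry :: "(real \<times> real) measure \<Rightarrow> monom2 \<Rightarrow> monom2 \<Rightarrow> real" where
  "moment_entry \<mu> r c = (\<integral>z. fst z ^ (fst r + fst c) * snd z ^ (snd r + snd c) \<partial>\<mu>)"

definition moment_matrix :: "(real \<times> real) measure \<Rightarrow> nat \<Rightarrow> real mat" where
  "moment_matrix \<mu> k =
     mat (length (monomials_upto k)) (length (monomials_upto k))
       (\<lambda>(r, c). moment_entry \<mu> (monomials_upto k ! r) (monomials_upto k ! c))"

definition recursive_relation_upto :: "(real \<times> real) measure \<Rightarrow> nat \<Rightarrow> poly2 \<Rightarrow> bool" where
  "recursive_relation_upto \<mu> k p \<longleftrightarrow>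
     moment_matrix \<mu> k *\<^sub>v coeff_vec k p = 0\<^sub>v (length (monomials_upto k))"

text \<open>The rows of the infinite moment matrix are applied to the finitely supported coefficient
  vector of \<open>p\<close>, so each product is a sum over the support of \<open>p\<close>.\<close>

definition recursive_relations :: "(real \<times> real) measure \<Rightarrow> poly2 set" where
  "recursive_relations \<mu> =
     {p. \<forall>r. (\<Sum>c \<in> Poly_Mapping.keys p. moment_entry \<mu> r c * Poly_Mapping.lookup p c) = 0}"

definition vandermonde_matrix ::
  "nat \<Rightarrow> (nat \<Rightarrow> real) \<Rightarrow> (nat \<Rightarrow> real) \<Rightarrow> nat \<Rightarrow> real mat" where
  "vandermonde_matrix n x y k =
     mat n (length (monomials_upto k))
       (\<lambda>(i, c). x i ^ fst (monomials_upto k ! c) * y i ^ snd (monomials_upto k ! c))"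

text \<open>Lexicographic order with \<open>x > y\<close>. The relation is written out because the order on pairs
  in scope is componentwise. Leading terms are meaningful only for nonzero polynomials.\<close>

definition lead_monom :: "poly2 \<Rightarrow> monom2" where
  "lead_monom p = (THE m. m \<in> Poly_Mapping.keys p \<and>
     (\<forall>m' \<in> Poly_Mapping.keys p. m' \<noteq> m \<longrightarrow> (m', m) \<in> less_than <*lex*> less_than))"

definition lead_term :: "poly2 \<Rightarrow> poly2" where
  "lead_term p = Poly_Mapping.single (lead_monom p) (Poly_Mapping.lookup p (lead_monom p))"

definition poly_ideal :: "poly2 set \<Rightarrow> bool" where
  "poly_ideal J \<longleftrightarrow> 0 \<in> J \<and> (\<forall>p\<in>J. \<forall>q\<in>J. p + q \<in> J) \<and> (\<forall>p\<in>J. \<forall>q. q * p \<in> J)"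

definition groebner_basis :: "poly2 set \<Rightarrow> poly2 set \<Rightarrow> bool" where
  "groebner_basis G I \<longleftrightarrow>
     G \<subseteq> I \<and> lead_term ` (I - {0}) \<subseteq> poly_ideal hull (lead_term ` (G - {0}))"

end

theory Submission
  imports Defs
begin

text \<open>Integrating against \<open>\<mu>\<close> is a weighted sum over the atoms, so the quadratic form of the
  moment matrix at \<open>p\<close> is $\sum_i \lambda_i\, p(x_i, y_i)^2$; as the weights are positive, the
  recursive relations are the polynomials vanishing at all atoms. For a finite set \<open>S\<close> of points,
  call a monomial reducible if on \<open>S\<close> it is a linear combination of lexicographically smaller
  monomials. The irreducible monomials are linearly independent on \<open>S\<close> and closed under taking
  divisors, so there are at most \<open>card S\<close> of them and each has degree less than \<open>card S\<close>. Hence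
  every reducible monomial is a multiple of a reducible one of degree at most \<open>card S\<close>, and
  rewriting the latter through irreducible monomials gives the Groebner basis.\<close>

section \<open>Evaluation of polynomials and the lexicographic order\<close>

definition monom_eval :: "real \<times> real \<Rightarrow> monom2 \<Rightarrow> real" where
  "monom_eval z m = fst z ^ fst m * snd z ^ snd m"

text \<open>The coefficient is the right factor so that an evaluation looks like a matrix row
  applied to the coefficient vector.\<close>

definition poly2_eval :: "poly2 \<Rightarrow> real \<times> real \<Rightarrow> real" where
  "poly2_eval p z = (\<Sum>m\<in>Poly_Mapping.keys p. monom_eval z m * Poly_Mapping.lookup p m)"

definition vanishing_ideal :: "(real \<times> real) set \<Rightarrow> poly2 set" where
  "vanishing_ideal S = {p. \<forall>z\<in>S. poly2_eval p z = 0}"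

abbreviation lex_less :: "monom2 \<Rightarrow> monom2 \<Rightarrow> bool" (infix "\<lless>" 50) where
  "a \<lless> b \<equiv> (a, b) \<in> less_than <*lex*> less_than"

lemma monom_eval_add: "monom_eval z (a + b) = monom_eval z a * monom_eval z b"
  by (simp add: monom_eval_def power_add)

lemma lex_less_add: "a \<lless> b \<Longrightarrow> s + a \<lless> s + b"
  by (cases a; cases b; cases s) auto

lemma lex_less_trans: "a \<lless> b \<Longrightarrow> b \<lless> c \<Longrightarrow> a \<lless> c"
  by (cases a; cases b; cases c) auto

lemma lex_less_asym: "a \<lless> b \<Longrightarrow> \<not> b \<lless> a"
  by (cases a; cases b) auto

lemma lex_less_linear: "a \<noteq> b \<Longrightarrow> a \<lless> b \<or> b \<lless> a"
  by (cases a; cases b) auto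

lemma wf_lex_less: "wf (less_than <*lex*> less_than)"
  by (simp add: wf_lex_prod)

lemma lex_max_exists:
  assumes "finite A" "A \<noteq> {}"
  obtains m where "m \<in> A" "\<And>a. a \<in> A \<Longrightarrow> a \<noteq> m \<Longrightarrow> a \<lless> m"
proof -
  have "\<exists>m\<in>A. \<forall>a\<in>A. a \<noteq> m \<longrightarrow> a \<lless> m"
    using assms
  proof (induction rule: finite_ne_induct)
    case (insert b A)
    then obtain m where "m \<in> A" "\<forall>a\<in>A. a \<noteq> m \<longrightarrow> a \<lless> m"
      by blast
    then show ?case
      using lex_less_linear lex_less_trans insert.hyps by (metis insert_iff)
  qed simp
  with that show thesis by blast
qed

lemma lead_monom_eqI:
  assumes "m \<in> Poly_Mapping.keys p"
    and "\<And>a. a \<in> Poly_Mapping.keys p \<Longrightarrow> a \<noteq> m \<Longrightarrow> a \<lless> m"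
  shows "lead_monom p = m"
  unfolding lead_monom_def
proof (rule the_equality)
  show "m \<in> Poly_Mapping.keys p \<and> (\<forall>a\<in>Poly_Mapping.keys p. a \<noteq> m \<longrightarrow> a \<lless> m)"
    using assms by blast
qed (metis assms lex_less_asym)

lemma
  assumes "p \<noteq> 0"
  shows lead_monom_in_keys: "lead_monom p \<in> Poly_Mapping.keys p"
    and less_lead_monom: "\<And>a. a \<in> Poly_Mapping.keys p \<Longrightarrow> a \<noteq> lead_monom p \<Longrightarrow> a \<lless> lead_monom p"
proof -
  obtain m where m: "m \<in> Poly_Mapping.keys p"
    "\<And>a. a \<in> Poly_Mapping.keys p \<Longrightarrow> a \<noteq> m \<Longrightarrow> a \<lless> m"
    using lex_max_exists[of "Poly_Mapping.keys p"] assms by auto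
  then have eq: "lead_monom p = m"
    by (rule lead_monom_eqI)
  show "lead_monom p \<in> Poly_Mapping.keys p"
    "\<And>a. a \<in> Poly_Mapping.keys p \<Longrightarrow> a \<noteq> lead_monom p \<Longrightarrow> a \<lless> lead_monom p"
    using m unfolding eq by blast+
qed

lemma sum_keys_superset:
  assumes "finite A" "Poly_Mapping.keys p \<subseteq> A"
  shows "(\<Sum>m\<in>Poly_Mapping.keys p. f m * Poly_Mapping.lookup p m) =
    (\<Sum>m\<in>A. f m * (Poly_Mapping.lookup p m :: real))"
  using assms by (intro sum.mono_neutral_left) (auto simp: in_keys_iff)

section \<open>Reducible monomials\<close>

text \<open>These are the leading monomials of the nonzero polynomials vanishing on
  \<open>S\<close>, described by functions on \<open>S\<close> alone. The conjunct
  \<open>finite A\<close> matters: a sum over an infinite set is 0 by convention.\<close>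

definition reducible :: "(real \<times> real) set \<Rightarrow> monom2 \<Rightarrow> bool" where
  "reducible S m \<longleftrightarrow> (\<exists>A c. finite A \<and> (\<forall>a\<in>A. a \<lless> m) \<and>
     (\<forall>z\<in>S. monom_eval z m = (\<Sum>a\<in>A. c a * monom_eval z a)))"

text \<open>Multiplying a relation on \<open>S\<close> by the monomial \<open>s\<close> shifts all
  its exponents by \<open>s\<close>, and the order is invariant under shifts.\<close>

lemma reducible_add:
  assumes "reducible S m"
  shows "reducible S (s + m)"
proof -
  obtain A c where A: "finite A" "\<forall>a\<in>A. a \<lless> m"
    "\<forall>z\<in>S. monom_eval z m = (\<Sum>a\<in>A. c a * monom_eval z a)"
    using assms unfolding reducible_def by blast
  \<comment> \<open>Subtraction of exponents is truncated, but every index here is some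
    \<open>s + a\<close>, so \<open>a - s\<close> recovers the original exponent exactly.\<close>
  have "monom_eval z (s + m) = (\<Sum>a\<in>(+) s ` A. c (a - s) * monom_eval z a)" if "z \<in> S" for z
    using A(3) that
    by (subst sum.reindex) (auto simp: monom_eval_add sum_distrib_left mult_ac intro!: sum.cong)
  then show ?thesis
    unfolding reducible_def using A(1,2)
    by (intro exI[of _ "(+) s ` A"] exI[of _ "\<lambda>a. c (a - s)"]) (auto simp del: in_lex_prod intro: lex_less_add)
qed

text \<open>The equation p = 0 on \<open>S\<close> can be solved for the leading monomial, since the
  leading coefficient is nonzero.\<close>

lemma reducible_lead_monom:
  assumes "p \<in> vanishing_ideal S" "p \<noteq> 0"
  shows "reducible S (lead_monom p)"
proof -
  define m where "m = lead_monom p"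
  have m: "m \<in> Poly_Mapping.keys p" "\<And>a. a \<in> Poly_Mapping.keys p \<Longrightarrow> a \<noteq> m \<Longrightarrow> a \<lless> m"
    using lead_monom_in_keys[OF assms(2)] less_lead_monom[OF assms(2)] by (auto simp: m_def)
  define l where "l = Poly_Mapping.lookup p m"
  have l: "l \<noteq> 0"
    using m(1) by (simp add: l_def in_keys_iff)
  have "monom_eval z m =
      (\<Sum>a\<in>Poly_Mapping.keys p - {m}. - Poly_Mapping.lookup p a / l * monom_eval z a)"
    if "z \<in> S" for z
  proof -
    have "0 = monom_eval z m * l +
        (\<Sum>a\<in>Poly_Mapping.keys p - {m}. monom_eval z a * Poly_Mapping.lookup p a)"
      using assms(1) that m(1)
      by (simp add: vanishing_ideal_def poly2_eval_def l_def sum.remove)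
    then have "monom_eval z m =
        - (\<Sum>a\<in>Poly_Mapping.keys p - {m}. monom_eval z a * Poly_Mapping.lookup p a) / l"
      using l by (subst eq_divide_eq) simp
    then show ?thesis
      by (simp add: sum_divide_distrib sum_negf mult_ac)
  qed
  then show ?thesis
    unfolding reducible_def m_def[symmetric] using m(2)
    by (intro exI[of _ "Poly_Mapping.keys p - {m}"]
        exI[of _ "\<lambda>a. - Poly_Mapping.lookup p a / l"]) (simp del: in_lex_prod)
qed

text \<open>Gaussian elimination, by induction on the set of equations: the unknowns are the
  \<open>c a\<close> and each point of \<open>S\<close> gives one equation.\<close>

lemma underdetermined_system:
  fixes f :: "'s \<Rightarrow> 'a \<Rightarrow> 'b::field"
  assumes "finite S" "finite A" "card S < card A"
  shows "\<exists>c. (\<exists>a\<in>A. c a \<noteq> 0) \<and> (\<forall>z\<in>S. (\<Sum>a\<in>A. c a * f z a) = 0)"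
  using assms
proof (induction arbitrary: A f rule: finite_induct)
  case empty
  then have "A \<noteq> {}" by auto
  then show ?case by (intro exI[of _ "\<lambda>_. 1"]) auto
next
  case (insert t S)
  show ?case
  proof (cases "\<forall>a\<in>A. f t a = 0")
    case True
    obtain c where "\<exists>a\<in>A. c a \<noteq> 0" "\<forall>z\<in>S. (\<Sum>a\<in>A. c a * f z a) = 0"
      using insert.IH[of A f] insert.prems insert.hyps by auto
    with True show ?thesis by auto
  next
    case False
    then obtain b where b: "b \<in> A" "f t b \<noteq> 0" by blast
    have "card S < card (A - {b})"
      using insert.prems insert.hyps b by simp
    \<comment> \<open>With pivot \<open>f t b\<close>, subtracting a multiple of equation
      \<open>t\<close> from equation \<open>z\<close> removes the unknown \<open>b\<close>; one
      equation and one unknown fewer remain.\<close>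
    then obtain c where c: "\<exists>a\<in>A - {b}. c a \<noteq> 0"
      "\<forall>z\<in>S. (\<Sum>a\<in>A - {b}. c a * (f z a - f z b * f t a / f t b)) = 0"
      using insert.IH[of "A - {b}" "\<lambda>z a. f z a - f z b * f t a / f t b"] insert.prems by auto
    define s where "s = (\<Sum>a\<in>A - {b}. c a * f t a)"
    \<comment> \<open>Back substitution: this value at \<open>b\<close> is the one that makes
      equation \<open>t\<close> hold.\<close>
    define d where "d = c(b := - s / f t b)"
    have d: "(\<Sum>a\<in>A. d a * f z a) = - s / f t b * f z b + (\<Sum>a\<in>A - {b}. c a * f z a)" for z
      using b insert.prems by (simp add: sum.remove d_def)
    have "(\<Sum>a\<in>A. d a * f z a) = 0" if "z \<in> insert t S" for z
    proof (cases "z = t")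
      case True
      then show ?thesis using b d[of t] by (simp add: s_def)
    next
      case False
      have "(\<Sum>a\<in>A - {b}. c a * (f z a - f z b * f t a / f t b)) =
          - s / f t b * f z b + (\<Sum>a\<in>A - {b}. c a * f z a)"
        by (simp add: s_def sum_distrib_left sum_distrib_right sum_divide_distrib
            right_diff_distrib sum_subtractf mult_ac)
      with c(2) that False show ?thesis
        unfolding d by simp
    qed
    moreover have "\<exists>a\<in>A. d a \<noteq> 0"
      using c(1) by (auto simp: d_def)
    ultimately show ?thesis by blast
  qed
qed

text \<open>More monomials than points would admit a nontrivial linear relation on \<open>S\<close>,
  and its largest monomial would then be reducible.\<close>

lemma card_irreducible_subset:
  assumes "finite S" "finite A" "A \<subseteq> {m. \<not> reducible S m}"
  shows "card A \<le> card S"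
proof (rule ccontr)
  assume "\<not> card A \<le> card S"
  then obtain c where c: "\<exists>a\<in>A. c a \<noteq> 0" "\<forall>z\<in>S. (\<Sum>a\<in>A. c a * monom_eval z a) = 0"
    using underdetermined_system[of S A monom_eval] assms by auto
  \<comment> \<open>Zero coefficients are dropped first, so that the coefficient of the largest
    remaining monomial can be divided by.\<close>
  define B where "B = {a\<in>A. c a \<noteq> 0}"
  have B: "finite B" "B \<noteq> {}"
    using c(1) assms(2) by (auto simp: B_def)
  then obtain m where m: "m \<in> B" "\<And>a. a \<in> B \<Longrightarrow> a \<noteq> m \<Longrightarrow> a \<lless> m"
    using lex_max_exists by metis
  have "monom_eval z m = (\<Sum>a\<in>B - {m}. - c a / c m * monom_eval z a)" if "z \<in> S" for z
  proof -
    have "(\<Sum>a\<in>B. c a * monom_eval z a) = (\<Sum>a\<in>A. c a * monom_eval z a)"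
      using assms(2) by (intro sum.mono_neutral_left) (auto simp: B_def)
    then have "0 = c m * monom_eval z m + (\<Sum>a\<in>B - {m}. c a * monom_eval z a)"
      using c(2) that B(1) m(1) by (simp add: sum.remove)
    moreover have "c m \<noteq> 0"
      using m(1) by (simp add: B_def)
    ultimately have "monom_eval z m = - (\<Sum>a\<in>B - {m}. c a * monom_eval z a) / c m"
      by (subst eq_divide_eq) (simp add: mult.commute[of "monom_eval z m"])
    then show ?thesis
      by (simp add: sum_divide_distrib sum_negf)
  qed
  then have "reducible S m"
    unfolding reducible_def using B(1) m(2)
    by (intro exI[of _ "B - {m}"] exI[of _ "\<lambda>a. - c a / c m"]) (simp del: in_lex_prod)
  with m(1) assms(3) show False
    by (auto simp: B_def)
qed

lemma finite_irreducible:
  assumes "finite S"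
  shows "finite {m. \<not> reducible S m}"
proof (rule ccontr)
  assume "infinite {m. \<not> reducible S m}"
  then obtain A where "A \<subseteq> {m. \<not> reducible S m}" "finite A" "card A = Suc (card S)"
    using infinite_arbitrarily_large by metis
  with card_irreducible_subset[OF assms, of A] show False by simp
qed

text \<open>By \<open>reducible_add\<close> all divisors of an irreducible monomial are irreducible.
  They form a box of size (i+1)(j+1) for m = (i, j), which is at most \<open>card S\<close> and
  exceeds i + j.\<close>

lemma degree_irreducible:
  assumes "finite S" "\<not> reducible S m"
  shows "fst m + snd m < card S"
proof -
  have "\<not> reducible S a" if "a \<in> {..fst m} \<times> {..snd m}" for a
  proof
    assume "reducible S a"
    then have "reducible S ((m - a) + a)" by (rule reducible_add)
    moreover have "(m - a) + a = m"
      using that by (auto simp: prod_eq_iff)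
    ultimately show False using assms(2) by simp
  qed
  then have "card ({..fst m} \<times> {..snd m}) \<le> card S"
    by (intro card_irreducible_subset assms(1)) auto
  then show ?thesis by simp
qed

text \<open>Well-founded induction replaces each reducible monomial in a relation by smaller
  irreducible ones. Induction on a count of smaller monomials would fail, as infinitely many powers
  of y lie below x.\<close>

lemma reducible_by_irreducible:
  assumes "finite S" "reducible S m"
  shows "\<exists>c. \<forall>z\<in>S. monom_eval z m =
    (\<Sum>a\<in>{a. \<not> reducible S a \<and> a \<lless> m}. c a * monom_eval z a)"
  using assms(2)
proof (induction m rule: wf_induct_rule[OF wf_lex_less])
  case (1 m)
  define I where "I = {a. \<not> reducible S a \<and> a \<lless> m}"
  have fin: "finite I"
    unfolding I_def by (rule finite_subset[OF _ finite_irreducible[OF assms(1)]]) auto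
  obtain A c where A: "finite A" "\<forall>a\<in>A. a \<lless> m"
    "\<forall>z\<in>S. monom_eval z m = (\<Sum>a\<in>A. c a * monom_eval z a)"
    using "1.prems" unfolding reducible_def by blast
  have "\<exists>d. \<forall>z\<in>S. monom_eval z a = (\<Sum>b\<in>I. d b * monom_eval z b)" if a: "a \<in> A" for a
  proof (cases "reducible S a")
    case True
    obtain d where d: "\<forall>z\<in>S. monom_eval z a =
        (\<Sum>b\<in>{b. \<not> reducible S b \<and> b \<lless> a}. d b * monom_eval z b)"
      using "1.IH"[OF bspec[OF A(2) a] True] by (rule exE)
    have *: "{b. \<not> reducible S b \<and> b \<lless> a} = I \<inter> {b. b \<lless> a}"
      using A(2) a lex_less_trans unfolding I_def by blast
    \<comment> \<open>Padding with zero coefficients brings the expansions of all \<open>a\<close>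
      in \<open>A\<close> to the common index set \<open>I\<close>.\<close>
    have "(\<Sum>b\<in>I. (if b \<lless> a then d b else 0) * monom_eval z b) =
        (\<Sum>b\<in>{b. \<not> reducible S b \<and> b \<lless> a}. d b * monom_eval z b)" for z
      unfolding * sum.inter_restrict[OF fin] by (rule sum.cong) auto
    with d show ?thesis
      by (intro exI[of _ "\<lambda>b. if b \<lless> a then d b else 0"]) (simp del: in_lex_prod)
  next
    case False
    then have "a \<in> I"
      using A(2) a unfolding I_def by blast
    with fin show ?thesis
      by (intro exI[of _ "\<lambda>b. if b = a then 1 else 0"]) (simp add: if_distrib[of "\<lambda>t. t * _"] cong: if_cong)
  qed
  then obtain d where d: "\<And>a z. a \<in> A \<Longrightarrow> z \<in> S \<Longrightarrow> monom_eval z a = (\<Sum>b\<in>I. d a b * monom_eval z b)"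
    by metis
  have "monom_eval z m = (\<Sum>b\<in>I. (\<Sum>a\<in>A. c a * d a b) * monom_eval z b)" if "z \<in> S" for z
  proof -
    have "monom_eval z m = (\<Sum>a\<in>A. \<Sum>b\<in>I. c a * d a b * monom_eval z b)"
      using A(3) d that by (simp add: sum_distrib_left mult.assoc)
    also have "\<dots> = (\<Sum>b\<in>I. \<Sum>a\<in>A. c a * d a b * monom_eval z b)"
      by (rule sum.swap)
    finally show ?thesis by (simp add: sum_distrib_right)
  qed
  then show ?case
    unfolding I_def[symmetric] by (intro exI[of _ "\<lambda>b. \<Sum>a\<in>A. c a * d a b"] ballI)
qed

text \<open>Dividing a monomial of degree above \<open>card S\<close> by one variable leaves degree
  at least \<open>card S\<close>, which is too large for an irreducible monomial. So the quotient is
  still reducible, and the division can be repeated.\<close>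

lemma reducible_decompose:
  assumes "finite S" "reducible S m"
  shows "\<exists>s b. m = s + b \<and> reducible S b \<and> fst b + snd b \<le> card S"
  using assms(2)
proof (induction "fst m + snd m" arbitrary: m rule: less_induct)
  case less
  show ?case
  proof (cases "fst m + snd m \<le> card S")
    case True
    with less.prems show ?thesis
      by (intro exI[of _ 0] exI[of _ m]) simp
  next
    case False
    obtain e a where e: "m = e + a" "fst m + snd m = Suc (fst a + snd a)"
    proof (cases "fst m")
      case 0
      \<comment> \<open>Here x does not divide \<open>m\<close>; the degree exceeds
        \<open>card S\<close>, so the exponent of y is positive and y can be split off.\<close>
      with False show thesis
        by (intro that[of "(0, 1)" "(0, snd m - 1)"]) (auto simp: prod_eq_iff)
    next
      case (Suc i)
      then show thesis
        by (intro that[of "(1, 0)" "(i, snd m)"]) (auto simp: prod_eq_iff)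
    qed
    have "reducible S a"
      using degree_irreducible[OF assms(1), of a] e False by fastforce
    then obtain s b where "a = s + b" "reducible S b" "fst b + snd b \<le> card S"
      using less.hyps[of a] e(2) by auto
    with e(1) show ?thesis
      by (intro exI[of _ "e + s"] exI[of _ b]) (simp add: add.assoc)
  qed
qed

section \<open>A Groebner basis of the vanishing ideal\<close>

text \<open>The polynomial is \<open>m\<close> minus its expansion in irreducible monomials. Being
  lexicographically smaller does not bound the total degree, so the degree bound on the tail comes
  from irreducibility.\<close>

lemma reducible_imp_monic_poly:
  assumes "finite S" "reducible S m" "fst m + snd m \<le> card S"
  shows "\<exists>p. p \<in> polys_upto (card S) \<and> p \<in> vanishing_ideal S \<and> p \<noteq> 0 \<and>
    lead_term p = Poly_Mapping.single m 1"
proof -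
  define I where "I = {a. \<not> reducible S a \<and> a \<lless> m}"
  have fin: "finite I"
    unfolding I_def by (rule finite_subset[OF _ finite_irreducible[OF assms(1)]]) auto
  have mI: "m \<notin> I"
    using assms(2) by (simp add: I_def)
  obtain c where c: "\<forall>z\<in>S. monom_eval z m = (\<Sum>a\<in>I. c a * monom_eval z a)"
    using reducible_by_irreducible[OF assms(1,2)] unfolding I_def by (rule exE)
  define p where
    "p = Abs_poly_mapping (\<lambda>a. if a = m then 1 else if a \<in> I then - c a else 0)"
  have lookup: "Poly_Mapping.lookup p = (\<lambda>a. if a = m then 1 else if a \<in> I then - c a else 0)"
    unfolding p_def
    by (rule lookup_Abs_poly_mapping)
      (rule finite_subset[of _ "insert m I"], use fin in \<open>auto split: if_splits\<close>)
  have keys: "Poly_Mapping.keys p \<subseteq> insert m I" "m \<in> Poly_Mapping.keys p"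
    by (auto simp: in_keys_iff lookup split: if_splits)
  have lead: "lead_monom p = m"
    using keys by (intro lead_monom_eqI) (auto simp: I_def simp del: in_lex_prod)
  have "poly2_eval p z = 0" if "z \<in> S" for z
  proof -
    have "poly2_eval p z = (\<Sum>a\<in>insert m I. monom_eval z a * Poly_Mapping.lookup p a)"
      unfolding poly2_eval_def using fin keys by (intro sum_keys_superset) auto
    also have "\<dots> = monom_eval z m + (\<Sum>a\<in>I. - (c a * monom_eval z a))"
      using fin mI by (auto simp: lookup intro!: sum.cong)
    finally show ?thesis
      using c that by (simp add: sum_negf)
  qed
  moreover have "p \<in> polys_upto (card S)"
    using keys(1) assms(3) degree_irreducible[OF assms(1)]
    unfolding polys_upto_def I_def by (fastforce simp del: in_lex_prod)
  moreover have "lead_term p = Poly_Mapping.single m 1"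
    by (simp add: lead_term_def lead lookup)
  moreover have "p \<noteq> 0"
    using keys(2) by auto
  ultimately show ?thesis
    by (intro exI[of _ p]) (simp add: vanishing_ideal_def)
qed

text \<open>One polynomial is taken for each reducible monomial of degree at most
  \<open>card S\<close>; every leading monomial of the ideal is a multiple of one of these.\<close>

lemma groebner_basis_vanishing_ideal:
  assumes "finite S"
  shows "\<exists>G. finite G \<and> G \<subseteq> polys_upto (card S) \<and> groebner_basis G (vanishing_ideal S)"
proof -
  define M where "M = {m. reducible S m \<and> fst m + snd m \<le> card S}"
  have "M \<subseteq> {..card S} \<times> {..card S}"
    by (auto simp: M_def)
  then have fin: "finite M"
    by (rule finite_subset) simp
  obtain g where g: "\<And>m. m \<in> M \<Longrightarrow> g m \<in> polys_upto (card S) \<and> g m \<in> vanishing_ideal S \<and>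
      g m \<noteq> 0 \<and> lead_term (g m) = Poly_Mapping.single m 1"
    using reducible_imp_monic_poly[OF assms] unfolding M_def mem_Collect_eq by metis
  have "lead_term p \<in> poly_ideal hull (lead_term ` (g ` M - {0}))"
    if p: "p \<in> vanishing_ideal S" "p \<noteq> 0" for p
    unfolding hull_def
  proof (rule InterI, clarify)
    \<comment> \<open>The hull is the intersection of all ideals containing the given leading terms,
      so an arbitrary such ideal is considered.\<close>
    fix J assume J: "poly_ideal J" "lead_term ` (g ` M - {0}) \<subseteq> J"
    obtain s b where sb: "lead_monom p = s + b" "b \<in> M"
      using reducible_decompose[OF assms reducible_lead_monom[OF p]] unfolding M_def by blast
    have "g b \<in> g ` M - {0}"
      using g[OF sb(2)] sb(2) by simp
    then have "lead_term (g b) \<in> J"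
      using J(2) by (metis imageI subsetD)
    then have "Poly_Mapping.single b 1 \<in> J"
      using g[OF sb(2)] by simp
    then have "Poly_Mapping.single s (Poly_Mapping.lookup p (lead_monom p)) * Poly_Mapping.single b 1 \<in> J"
      using J(1) by (simp add: poly_ideal_def)
    then show "lead_term p \<in> J"
      by (simp add: lead_term_def mult_single sb(1))
  qed
  moreover have "g ` M \<subseteq> polys_upto (card S)" "g ` M \<subseteq> vanishing_ideal S"
    using g by auto
  ultimately show ?thesis
    using fin unfolding groebner_basis_def
    by (intro exI[of _ "g ` M"]) blast
qed

section \<open>Moments of a finitely atomic measure\<close>

text \<open>Almost everywhere \<open>f\<close> equals a finite combination of indicators of single
  atoms. The detour through the set \<open>S\<close> of atoms is needed because the numbered atoms
  may coincide.\<close>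

lemma integral_finitely_atomic:
  fixes f :: "real \<times> real \<Rightarrow> real"
  assumes "finitely_atomic_prob \<mu> n w x y" "f \<in> borel_measurable borel"
  shows "(\<integral>z. f z \<partial>\<mu>) = (\<Sum>i<n. w i * f (x i, y i))"
proof -
  interpret prob_space \<mu>
    using assms by (simp add: finitely_atomic_prob_def)
  have sets: "sets \<mu> = sets borel"
    and w: "\<And>i. i < n \<Longrightarrow> 0 < w i"
    and em: "\<And>A. A \<in> sets borel \<Longrightarrow>
      emeasure \<mu> A = (\<Sum>i<n. ennreal (w i) * emeasure (return borel (x i, y i)) A)"
    using assms by (auto simp: finitely_atomic_prob_def)
  have space: "space \<mu> = UNIV"
    using sets_eq_imp_space_eq[OF sets] by simp
  define S where "S = (\<lambda>i. (x i, y i)) ` {..<n}"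
  have S: "finite S" "\<And>i. i < n \<Longrightarrow> (x i, y i) \<in> S"
    by (auto simp: S_def)
  have em': "emeasure \<mu> A = ennreal (\<Sum>i<n. w i * indicator A (x i, y i))" if "A \<in> sets borel" for A
  proof -
    have "emeasure \<mu> A = (\<Sum>i<n. ennreal (w i * indicator A (x i, y i)))"
      unfolding em[OF that] using that w
      by (intro sum.cong) (auto simp: indicator_def)
    also have "\<dots> = ennreal (\<Sum>i<n. w i * indicator A (x i, y i))"
      using w by (intro sum_ennreal) (auto simp: less_imp_le)
    finally show ?thesis .
  qed
  have meas: "measure \<mu> {s} = (\<Sum>i<n. w i * indicator {s} (x i, y i))" for s
    unfolding measure_def using w
    by (subst em') (auto simp: less_imp_le intro!: enn2real_ennreal sum_nonneg)
  have "emeasure \<mu> (- S) = 0"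
    using S by (subst em') (auto intro!: borel_open open_Compl finite_imp_closed sum.neutral)
  then have "AE z in \<mu>. z \<in> S"
    using S(1) by (intro AE_I[of _ _ "- S"]) (auto simp: sets intro!: borel_open open_Compl finite_imp_closed)
  then have "AE z in \<mu>. f z = (\<Sum>s\<in>S. f s * indicator {s} z)"
    by eventually_elim (use S(1) in \<open>simp add: indicator_def if_distrib cong: if_cong\<close>)
  then have "(\<integral>z. f z \<partial>\<mu>) = (\<integral>z. (\<Sum>s\<in>S. f s * indicator {s} z) \<partial>\<mu>)"
    using assms(2) by (intro integral_cong_AE) (auto simp: measurable_cong_sets[OF sets refl])
  also have "\<dots> = (\<Sum>s\<in>S. f s * measure \<mu> {s})"
    by (subst Bochner_Integration.integral_sum) (auto simp: sets space less_top[symmetric])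
  \<comment> \<open>The mass of \<open>{s}\<close> collects the weights of all indices located at
    \<open>s\<close>; swapping the sums returns to one term per index.\<close>
  also have "\<dots> = (\<Sum>i<n. \<Sum>s\<in>S. f s * (w i * indicator {s} (x i, y i)))"
    unfolding meas sum_distrib_left by (rule sum.swap)
  also have "\<dots> = (\<Sum>i<n. w i * f (x i, y i))"
  proof (rule sum.cong)
    fix i assume "i \<in> {..<n}"
    then show "(\<Sum>s\<in>S. f s * (w i * indicator {s} (x i, y i))) = w i * f (x i, y i)"
      using S by (subst sum.remove[of _ "(x i, y i)"]) (auto simp: indicator_def intro!: sum.neutral)
  qed simp
  finally show ?thesis .
qed

text \<open>Row \<open>r\<close> applied to \<open>p\<close> is the integral of the monomial
  \<open>r\<close> times \<open>p\<close>.\<close>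

lemma moment_row_eq:
  assumes "finitely_atomic_prob \<mu> n w x y"
  shows "(\<Sum>c\<in>Poly_Mapping.keys p. moment_entry \<mu> r c * Poly_Mapping.lookup p c) =
    (\<Sum>i<n. w i * monom_eval (x i, y i) r * poly2_eval p (x i, y i))"
proof -
  have "moment_entry \<mu> r c = (\<Sum>i<n. w i * (monom_eval (x i, y i) r * monom_eval (x i, y i) c))" for c
    unfolding moment_entry_def
    by (subst integral_finitely_atomic[OF assms])
      (simp_all add: borel_prod[symmetric] monom_eval_def power_add mult_ac)
  then have "(\<Sum>c\<in>Poly_Mapping.keys p. moment_entry \<mu> r c * Poly_Mapping.lookup p c) =
      (\<Sum>c\<in>Poly_Mapping.keys p. \<Sum>i<n.
        w i * monom_eval (x i, y i) r * (monom_eval (x i, y i) c * Poly_Mapping.lookup p c))"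
    by (simp add: sum_distrib_left mult_ac)
  also have "\<dots> = (\<Sum>i<n. w i * monom_eval (x i, y i) r * poly2_eval p (x i, y i))"
    unfolding poly2_eval_def sum_distrib_left by (rule sum.swap)
  finally show ?thesis .
qed

text \<open>The row set \<open>R\<close> is left free so that both the truncated matrix and the
  infinite one are covered. It only has to contain the support of \<open>p\<close>, since the rows
  are paired with the coefficients of \<open>p\<close> itself.\<close>

lemma moment_rows_zero_iff:
  assumes "finitely_atomic_prob \<mu> n w x y" "Poly_Mapping.keys p \<subseteq> R"
  shows "(\<forall>r\<in>R. (\<Sum>c\<in>Poly_Mapping.keys p. moment_entry \<mu> r c * Poly_Mapping.lookup p c) = 0) \<longleftrightarrow>
    (\<forall>i<n. poly2_eval p (x i, y i) = 0)"
proof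
  assume 0: "\<forall>r\<in>R. (\<Sum>c\<in>Poly_Mapping.keys p. moment_entry \<mu> r c * Poly_Mapping.lookup p c) = 0"
  have w: "\<And>i. i < n \<Longrightarrow> 0 < w i"
    using assms(1) by (simp add: finitely_atomic_prob_def)
  \<comment> \<open>One factor of the square is expanded into monomials, which exhibits the
    quadratic form as a combination of rows.\<close>
  have "(\<Sum>i<n. w i * (poly2_eval p (x i, y i))\<^sup>2) =
      (\<Sum>i<n. \<Sum>r\<in>Poly_Mapping.keys p.
        Poly_Mapping.lookup p r * (w i * monom_eval (x i, y i) r * poly2_eval p (x i, y i)))"
  proof (rule sum.cong)
    fix i
    have "w i * (poly2_eval p (x i, y i))\<^sup>2 = w i * poly2_eval p (x i, y i) *
        (\<Sum>r\<in>Poly_Mapping.keys p. monom_eval (x i, y i) r * Poly_Mapping.lookup p r)"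
      by (simp add: power2_eq_square flip: poly2_eval_def)
    then show "w i * (poly2_eval p (x i, y i))\<^sup>2 = (\<Sum>r\<in>Poly_Mapping.keys p.
        Poly_Mapping.lookup p r * (w i * monom_eval (x i, y i) r * poly2_eval p (x i, y i)))"
      by (simp add: sum_distrib_left mult_ac)
  qed simp
  also have "\<dots> = (\<Sum>r\<in>Poly_Mapping.keys p. Poly_Mapping.lookup p r *
      (\<Sum>i<n. w i * monom_eval (x i, y i) r * poly2_eval p (x i, y i)))"
    unfolding sum_distrib_left by (rule sum.swap)
  also have "\<dots> = 0"
    using 0 assms(2) unfolding moment_row_eq[OF assms(1)] by (intro sum.neutral) auto
  finally have "\<forall>i\<in>{..<n}. w i * (poly2_eval p (x i, y i))\<^sup>2 = 0"
    using w by (subst (asm) sum_nonneg_eq_0_iff) (auto simp: less_imp_le)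
  then show "\<forall>i<n. poly2_eval p (x i, y i) = 0"
    using w by force
qed (simp add: moment_row_eq[OF assms(1)])

section \<open>Matrices indexed by the ordered list of monomials\<close>

lemma set_monomials_upto: "set (monomials_upto k) = {m. fst m + snd m \<le> k}"
proof -
  have "\<exists>d\<in>{0..<Suc k}. (a, b) \<in> (\<lambda>j. (d - j, j)) ` {0..<Suc d}" if "a + b \<le> k" for a b
    using that by (intro bexI[of _ "a + b"] image_eqI[of _ _ b]) auto
  then show ?thesis
    by (auto simp: monomials_upto_def simp del: upt_Suc)
qed

lemma keys_subset_monomials_upto:
  "p \<in> polys_upto k \<Longrightarrow> Poly_Mapping.keys p \<subseteq> set (monomials_upto k)"
  by (auto simp: set_monomials_upto polys_upto_def)

lemma distinct_monomials_upto: "distinct (monomials_upto k)"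
proof (induction k)
  case (Suc k)
  have "monomials_upto (Suc k) = monomials_upto k @ map (\<lambda>j. (Suc k - j, j)) [0..<Suc (Suc k)]"
    by (simp add: monomials_upto_def)
  \<comment> \<open>The new block has total degree exactly \<open>Suc k\<close>, hence is disjoint
    from the earlier ones; within it the exponent of y separates the entries.\<close>
  moreover have "distinct (map (\<lambda>j. (Suc k - j, j)) [0..<Suc (Suc k)])"
    unfolding distinct_map by (auto simp: inj_on_def simp del: upt_Suc)
  ultimately show ?case
    using Suc by (auto simp: set_monomials_upto simp del: upt_Suc)
qed (simp add: monomials_upto_def)

text \<open>The entry function \<open>f\<close> is generic so that the moment and Vandermonde
  matrices are treated alike. As the list has no repetitions and covers the support of
  \<open>p\<close>, a sum over columns is a sum over that support.\<close>

lemma mat_mult_coeff_vec_eq_0_iff: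
  assumes "p \<in> polys_upto k"
  shows "mat r (length (monomials_upto k)) (\<lambda>(i, c). f i (monomials_upto k ! c)) *\<^sub>v coeff_vec k p = 0\<^sub>v r
    \<longleftrightarrow> (\<forall>i<r. (\<Sum>c\<in>Poly_Mapping.keys p. f i c * Poly_Mapping.lookup p c) = 0)"
proof -
  have "(\<Sum>j = 0..<length (monomials_upto k).
      f i (monomials_upto k ! j) * Poly_Mapping.lookup p (monomials_upto k ! j)) =
      (\<Sum>c\<in>Poly_Mapping.keys p. f i c * Poly_Mapping.lookup p c)" for i
  proof -
    have "(\<Sum>j = 0..<length (monomials_upto k).
        f i (monomials_upto k ! j) * Poly_Mapping.lookup p (monomials_upto k ! j)) =
        (\<Sum>c\<in>set (monomials_upto k). f i c * Poly_Mapping.lookup p c)"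
      by (intro sum.reindex_bij_betw[of "(!) (monomials_upto k)"] bij_betw_nth
          distinct_monomials_upto) auto
    also have "\<dots> = (\<Sum>c\<in>Poly_Mapping.keys p. f i c * Poly_Mapping.lookup p c)"
      using keys_subset_monomials_upto[OF assms] by (intro sum_keys_superset[symmetric]) simp_all
    finally show ?thesis .
  qed
  then show ?thesis
    by (simp add: vec_eq_iff scalar_prod_def coeff_vec_def)
qed

lemma coeff_vec_in_vandermonde_kernel_iff:
  assumes "p \<in> polys_upto k"
  shows "coeff_vec k p \<in> mat_kernel (vandermonde_matrix n x y k) \<longleftrightarrow>
    (\<forall>i<n. poly2_eval p (x i, y i) = 0)"
  using mat_mult_coeff_vec_eq_0_iff[OF assms, of n "\<lambda>i. monom_eval (x i, y i)"]
  by (simp add: mat_kernel_def vandermonde_matrix_def poly2_eval_def monom_eval_def coeff_vec_def)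

lemma recursive_relation_upto_iff:
  assumes "finitely_atomic_prob \<mu> n w x y" "p \<in> polys_upto k"
  shows "recursive_relation_upto \<mu> k p \<longleftrightarrow> (\<forall>i<n. poly2_eval p (x i, y i) = 0)"
proof -
  have "recursive_relation_upto \<mu> k p \<longleftrightarrow> (\<forall>r\<in>set (monomials_upto k).
      (\<Sum>c\<in>Poly_Mapping.keys p. moment_entry \<mu> r c * Poly_Mapping.lookup p c) = 0)"
    unfolding recursive_relation_upto_def moment_matrix_def
    by (subst mat_mult_coeff_vec_eq_0_iff[OF assms(2)]) (simp add: all_set_conv_all_nth)
  also have "\<dots> \<longleftrightarrow> (\<forall>i<n. poly2_eval p (x i, y i) = 0)"
    by (rule moment_rows_zero_iff[OF assms(1) keys_subset_monomials_upto[OF assms(2)]])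
  finally show ?thesis .
qed

lemma recursive_relations_eq:
  assumes "finitely_atomic_prob \<mu> n w x y"
  shows "recursive_relations \<mu> = vanishing_ideal ((\<lambda>i. (x i, y i)) ` {..<n})"
  using moment_rows_zero_iff[OF assms, of _ UNIV]
  by (auto simp: recursive_relations_def vanishing_ideal_def)

theorem proposition3p6:
  fixes \<mu> :: "(real \<times> real) measure"
    and n :: nat
    and w x y :: "nat \<Rightarrow> real"
  assumes "finitely_atomic_prob \<mu> n w x y"
  shows "(\<forall>k\<ge>1. \<forall>p \<in> polys_upto k.
            recursive_relation_upto \<mu> k p \<longleftrightarrow>
            coeff_vec k p \<in> mat_kernel (vandermonde_matrix n x y k)) \<and>
         (\<forall>k\<ge>n. \<exists>G. finite G \<and>
            G \<subseteq> {p \<in> polys_upto k. coeff_vec k p \<in> mat_kernel (vandermonde_matrix n x y k)} \<and>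
            groebner_basis G (recursive_relations \<mu>))"
proof (intro conjI allI impI ballI)
  fix k p assume "p \<in> polys_upto k"
  then show "recursive_relation_upto \<mu> k p \<longleftrightarrow>
      coeff_vec k p \<in> mat_kernel (vandermonde_matrix n x y k)"
    using recursive_relation_upto_iff[OF assms] coeff_vec_in_vandermonde_kernel_iff by simp
next
  fix k assume "n \<le> k"
  define S where "S = (\<lambda>i. (x i, y i)) ` {..<n}"
  \<comment> \<open>Repeated atoms can only make \<open>S\<close> smaller than \<open>n\<close>, so
    the degree bound \<open>card S\<close> of the basis stays within \<open>k\<close>.\<close>
  have "card S \<le> k"
    using card_image_le[of "{..<n}" "\<lambda>i. (x i, y i)"] \<open>n \<le> k\<close> by (simp add: S_def)
  then have upto: "polys_upto (card S) \<subseteq> polys_upto k"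
    by (fastforce simp: polys_upto_def)
  obtain G where G: "finite G" "G \<subseteq> polys_upto (card S)" "groebner_basis G (vanishing_ideal S)"
    using groebner_basis_vanishing_ideal[of S] by (auto simp: S_def)
  have "coeff_vec k p \<in> mat_kernel (vandermonde_matrix n x y k)" if "p \<in> G" for p
  proof -
    have "p \<in> polys_upto k" "p \<in> vanishing_ideal S"
      using that G(2,3) upto by (auto simp: groebner_basis_def)
    then show ?thesis
      by (simp add: coeff_vec_in_vandermonde_kernel_iff vanishing_ideal_def S_def)
  qed
  with G upto show "\<exists>G. finite G \<and>
      G \<subseteq> {p \<in> polys_upto k. coeff_vec k p \<in> mat_kernel (vandermonde_matrix n x y k)} \<and>
      groebner_basis G (recursive_relations \<mu>)"
    unfolding recursive_relations_eq[OF assms] S_def[symmetric] by blast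
qed

end
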